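(* Let $\ell:\mathbb{R}^{n+1}\times\mathbb{R}^{m+1}\times\mathbb{R}^{s+1}\to\mathbb{R}$ be a trilinear form. There is a bijection between classes of extreme points of $\ell$ and fixed points of the map $$\nabla\ell:\mathbb{P}^n\times\mathbb{P}^m\times\mathbb{P}^s\to\mathbb{P}^n\times\mathbb{P}^m\times\mathbb{P}^s,\qquad ([x],[y],[z])\mapsto\left(\left[\frac{\partial\ell}{\partial x}(x,y,z)\right],\left[\frac{\partial\ell}{\partial y}(x,y,z)\right],\left[\frac{\partial\ell}{\partial z}(x,y,z)\right]\right).$$
   Context: $\mathbb{P}^n$ denotes the real projective space of lines through the origin in $\mathbb{R}^{n+1}$, and $[v]\in\mathbb{P}^n$ is the line spanned by a nonzero vector $v$. $\mathbb{S}^n\subseteq\mathbb{R}^{n+1}$ is the unit sphere for the Euclidean norm. Write $x=(x_0,\dots,x_n)$, $y=(y_0,\dots,y_m)$, $z=(z_0,\dots,z_s)$ and $\frac{\partial\ell}{\partial x}=\left(\frac{\partial\ell}{\partial x_0},\dots,\frac{\partial\ell}{\partial x_n}\right)$, similarly for $\frac{\partial\ell}{\partial y}$ and $\frac{\partial\ell}{\partial z}$. The map $\nabla\ell$ is not defined at the points where one of these three partial gradients vanishes. A point $(x,y,z)\in\mathbb{S}^n\times\mathbb{S}^m\times\mathbb{S}^s$ is an extreme point of $\ell$ if there exist $\alpha,\beta,\lambda\in\mathbb{R}$ with $$\frac{\partial\ell}{\partial x}(x,y,z)=2\alpha x,\quad \frac{\partial\ell}{\partial y}(x,y,z)=2\beta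 y,\quad \frac{\partial\ell}{\partial z}(x,y,z)=2\lambda z.$$ If $(x,y,z)$ is an extreme point then so are all the points $(\pm x,\pm y,\pm z)$ (independent signs); these points are said to belong to the same class.
   Formalization: Only classes of extreme points at which ∇ℓ is defined (no partial gradient vanishes) are counted; without this the claim fails, e.g. for ℓ = 0 every point of the product of spheres is extreme but ∇ℓ has no fixed points. *)

theory Defs
  imports "HOL-Analysis.Analysis"
begin

text \<open>A space of dimension \<open>n + 1\<close> is \<open>real ^ 'n\<close> with \<open>CARD('n) = n + 1\<close>; the type variables
  \<open>'n\<close>, \<open>'m\<close>, \<open>'s\<close> are independent, so all \<open>n, m, s \<ge> 0\<close> are covered.\<close>

definition trilinear ::
  "(real ^ 'n \<Rightarrow> real ^ 'm \<Rightarrow> real ^ 's \<Rightarrow> real) \<Rightarrow> bool" where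
  "trilinear l \<longleftrightarrow>
     (\<forall>y z. linear (\<lambda>x. l x y z)) \<and> (\<forall>x z. linear (\<lambda>y. l x y z)) \<and> (\<forall>x y. linear (\<lambda>z. l x y z))"

definition gradient :: "(real ^ 'n \<Rightarrow> real) \<Rightarrow> real ^ 'n \<Rightarrow> real ^ 'n" where
  "gradient f x = (\<chi> i. deriv (\<lambda>t. f (x + t *\<^sub>R axis i 1)) 0)"

definition grad_x ::
  "(real ^ 'n \<Rightarrow> real ^ 'm \<Rightarrow> real ^ 's \<Rightarrow> real) \<Rightarrow> real ^ 'n \<Rightarrow> real ^ 'm \<Rightarrow> real ^ 's \<Rightarrow> real ^ 'n" where
  "grad_x l x y z = gradient (\<lambda>u. l u y z) x"

definition grad_y ::
  "(real ^ 'n \<Rightarrow> real ^ 'm \<Rightarrow> real ^ 's \<Rightarrow> real) \<Rightarrow> real ^ 'n \<Rightarrow> real ^ 'm \<Rightarrow> real ^ 's \<Rightarrow> real ^ 'm" where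
  "grad_y l x y z = gradient (\<lambda>v. l x v z) y"

definition grad_z ::
  "(real ^ 'n \<Rightarrow> real ^ 'm \<Rightarrow> real ^ 's \<Rightarrow> real) \<Rightarrow> real ^ 'n \<Rightarrow> real ^ 'm \<Rightarrow> real ^ 's \<Rightarrow> real ^ 's" where
  "grad_z l x y z = gradient (\<lambda>w. l x y w) z"

definition extreme_points ::
  "(real ^ 'n \<Rightarrow> real ^ 'm \<Rightarrow> real ^ 's \<Rightarrow> real) \<Rightarrow> ((real ^ 'n) \<times> (real ^ 'm) \<times> (real ^ 's)) set" where
  "extreme_points l = {(x, y, z). x \<in> sphere 0 1 \<and> y \<in> sphere 0 1 \<and> z \<in> sphere 0 1 \<and>
     (\<exists>\<alpha> \<beta> \<gamma> :: real. grad_x l x y z = (2 * \<alpha>) *\<^sub>R x \<and>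
                      grad_y l x y z = (2 * \<beta>) *\<^sub>R y \<and>
                      grad_z l x y z = (2 * \<gamma>) *\<^sub>R z)}"

fun point_class ::
  "(real ^ 'n) \<times> (real ^ 'm) \<times> (real ^ 's) \<Rightarrow> ((real ^ 'n) \<times> (real ^ 'm) \<times> (real ^ 's)) set" where
  "point_class (x, y, z) = {x, - x} \<times> {y, - y} \<times> {z, - z}"

definition proj_space :: "(real ^ 'n) set set" where
  "proj_space = {L. subspace L \<and> dim L = 1}"

abbreviation proj_point :: "real ^ 'n \<Rightarrow> (real ^ 'n) set" where
  "proj_point v \<equiv> span {v}"

definition proj_rep :: "(real ^ 'n) set \<Rightarrow> real ^ 'n" where
  "proj_rep L = (SOME v. v \<in> L \<and> v \<noteq> 0)"

text \<open>The map \<open>\<nabla>l\<close> is partial: it is undefined where one of the three partial gradients vanishes.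
  It is evaluated on chosen representatives; \<open>nabla_proj_point\<close> below shows that for trilinear
  \<open>l\<close> neither the value nor definedness depends on the choice.\<close>

definition nabla ::
  "(real ^ 'n \<Rightarrow> real ^ 'm \<Rightarrow> real ^ 's \<Rightarrow> real) \<Rightarrow>
   ((real ^ 'n) set \<times> (real ^ 'm) set \<times> (real ^ 's) set) \<rightharpoonup>
   ((real ^ 'n) set \<times> (real ^ 'm) set \<times> (real ^ 's) set)" where
  "nabla l = (\<lambda>(X, Y, Z).
     let x = proj_rep X; y = proj_rep Y; z = proj_rep Z in
     if X \<in> proj_space \<and> Y \<in> proj_space \<and> Z \<in> proj_space \<and>
        grad_x l x y z \<noteq> 0 \<and> grad_y l x y z \<noteq> 0 \<and> grad_z l x y z \<noteq> 0
     then Some (proj_point (grad_x l x y z), proj_point (grad_y l x y z), proj_point (grad_z l x y z))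
     else None)"

definition nabla_fixed_points ::
  "(real ^ 'n \<Rightarrow> real ^ 'm \<Rightarrow> real ^ 's \<Rightarrow> real) \<Rightarrow>
   ((real ^ 'n) set \<times> (real ^ 'm) set \<times> (real ^ 's) set) set" where
  "nabla_fixed_points l = {P \<in> proj_space \<times> proj_space \<times> proj_space. nabla l P = Some P}"

lemma gradient_linear:
  assumes "linear f"
  shows "gradient f x = (\<chi> i. f (axis i 1))"
proof -
  have "deriv (\<lambda>t. f (x + t *\<^sub>R axis i 1)) 0 = f (axis i 1)" for i
    by (rule DERIV_imp_deriv)
       (auto intro!: derivative_eq_intros simp: linear_add[OF assms] linear_cmul[OF assms])
  then show ?thesis by (simp add: gradient_def)
qed

lemma grad_scaleR:
  assumes "trilinear l"
  shows "grad_x l (a *\<^sub>R x) (b *\<^sub>R y) (c *\<^sub>R z) = (b * c) *\<^sub>R grad_x l x y z"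
    and "grad_y l (a *\<^sub>R x) (b *\<^sub>R y) (c *\<^sub>R z) = (a * c) *\<^sub>R grad_y l x y z"
    and "grad_z l (a *\<^sub>R x) (b *\<^sub>R y) (c *\<^sub>R z) = (a * b) *\<^sub>R grad_z l x y z"
proof -
  have lin: "linear (\<lambda>x. l x y z)" "linear (\<lambda>y. l x y z)" "linear (\<lambda>z. l x y z)" for x y z
    using assms by (auto simp: trilinear_def)
  note cmul = linear_cmul[OF lin(1)] linear_cmul[OF lin(2)] linear_cmul[OF lin(3)]
  have grad: "grad_x l x y z = (\<chi> i. l (axis i 1) y z)"
    "grad_y l x y z = (\<chi> i. l x (axis i 1) z)"
    "grad_z l x y z = (\<chi> i. l x y (axis i 1))" for x y z
    using lin by (simp_all add: grad_x_def grad_y_def grad_z_def gradient_linear)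
  show "grad_x l (a *\<^sub>R x) (b *\<^sub>R y) (c *\<^sub>R z) = (b * c) *\<^sub>R grad_x l x y z"
    "grad_y l (a *\<^sub>R x) (b *\<^sub>R y) (c *\<^sub>R z) = (a * c) *\<^sub>R grad_y l x y z"
    "grad_z l (a *\<^sub>R x) (b *\<^sub>R y) (c *\<^sub>R z) = (a * b) *\<^sub>R grad_z l x y z"
    by (simp_all add: grad vec_eq_iff cmul)
qed

lemma proj_point_in_proj_space: "v \<noteq> 0 \<Longrightarrow> proj_point v \<in> proj_space"
  by (simp add: proj_space_def dim_span dim_singleton)

lemma proj_point_scaleR:
  fixes c :: real
  shows "c \<noteq> 0 \<Longrightarrow> proj_point (c *\<^sub>R v) = proj_point v"
  using span_image_scale[of "{v}" "\<lambda>_. c"] by simp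

lemma proj_rep_proj_point:
  assumes "v \<noteq> 0"
  obtains c where "c \<noteq> 0" and "proj_rep (proj_point v) = c *\<^sub>R v"
proof -
  have "proj_rep (proj_point v) \<in> proj_point v \<and> proj_rep (proj_point v) \<noteq> 0"
    unfolding proj_rep_def by (rule someI[where x = v]) (simp add: assms span_base)
  then show thesis
    using that by (auto simp: span_singleton)
qed

lemma nabla_proj_point:
  assumes "trilinear l" and "x \<noteq> 0" and "y \<noteq> 0" and "z \<noteq> 0"
  shows "nabla l (proj_point x, proj_point y, proj_point z) =
    (if grad_x l x y z \<noteq> 0 \<and> grad_y l x y z \<noteq> 0 \<and> grad_z l x y z \<noteq> 0
     then Some (proj_point (grad_x l x y z), proj_point (grad_y l x y z), proj_point (grad_z l x y z))
     else None)"
proof -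
  obtain a where a: "a \<noteq> 0" "proj_rep (proj_point x) = a *\<^sub>R x"
    using proj_rep_proj_point[OF assms(2)] .
  obtain b where b: "b \<noteq> 0" "proj_rep (proj_point y) = b *\<^sub>R y"
    using proj_rep_proj_point[OF assms(3)] .
  obtain c where c: "c \<noteq> 0" "proj_rep (proj_point z) = c *\<^sub>R z"
    using proj_rep_proj_point[OF assms(4)] .
  show ?thesis
    using a b c assms
    by (simp add: nabla_def Let_def grad_scaleR proj_point_in_proj_space proj_point_scaleR)
qed

end

theory Submission
  imports Defs
begin

text \<open>A nonzero partial gradient is a multiple of x exactly when it spans the same line as x.
  So, where \<open>nabla l\<close> is defined, the three equations of an extreme point say that its
  triple of lines is fixed (\<open>proj_point_eq_iff_eigen\<close>,
  \<open>extreme_point_iff_fixed_point\<close>). Trilinearity allows evaluation at unit vectors: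
  nonzero rescalings of x, y, z rescale the gradients by nonzero factors.

  Every line contains exactly two unit vectors, which are antipodal
  (\<open>proj_space_unit_vector\<close>, \<open>antipodal_pair_eq_iff_proj_point_eq\<close>). Hence
  each fixed point comes from extreme points, and those over it form one class, so taking spans
  descends to a bijection on classes (\<open>bij_betw_image_quotient\<close>). Extreme points with a
  vanishing partial gradient stay outside the correspondence, because \<open>nabla l\<close> has no
  value there.\<close>

lemma bij_betw_image_quotient:
  assumes same_fibres: "\<And>a b. a \<in> A \<Longrightarrow> b \<in> A \<Longrightarrow> q a = q b \<longleftrightarrow> p a = p b"
  obtains f where "bij_betw f (q ` A) (p ` A)" and "\<And>a. a \<in> A \<Longrightarrow> f (q a) = p a"
proof
  \<comment> \<open>The chosen preimage does not matter, since \<open>p\<close> is constant on the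
    fibres of \<open>q\<close>; that \<open>p\<close> also separates these fibres makes
    \<open>f\<close> injective.\<close>
  define f where "f = (\<lambda>c. p (inv_into A q c))"
  show f: "f (q a) = p a" if "a \<in> A" for a
  proof -
    have "inv_into A q (q a) \<in> A" "q (inv_into A q (q a)) = q a"
      using that by (auto intro: inv_into_into f_inv_into_f)
    then show ?thesis
      using same_fibres that unfolding f_def by blast
  qed
  have "inj_on f (q ` A)"
    by (rule inj_onI) (auto simp: f same_fibres)
  moreover have "f ` q ` A = p ` A"
    by (auto simp: f image_iff)
  ultimately show "bij_betw f (q ` A) (p ` A)"
    by (simp add: bij_betw_def)
qed

text \<open>Needed for surjectivity. A basis of a one-dimensional space is a single nonzero vector,
  and normalising it keeps its span.\<close>

lemma proj_space_unit_vector: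
  fixes X :: "(real ^ 'n) set"
  assumes "X \<in> proj_space"
  obtains x where "norm x = 1" and "X = proj_point x"
proof -
  have X: "subspace X" "dim X = 1"
    using assms by (auto simp: proj_space_def)
  obtain B where B: "B \<subseteq> X" "independent B" "X \<subseteq> span B" "card B = dim X"
    using basis_exists by blast
  obtain v where v: "B = {v}"
    using B(4) X(2) by (metis card_1_singletonE)
  have "v \<noteq> 0"
    using B(2) v by auto
  have "X = span {v}"
    using B v X(1) span_minimal by blast
  also have "\<dots> = proj_point (sgn v)"
    using \<open>v \<noteq> 0\<close> by (simp add: sgn_div_norm proj_point_scaleR)
  finally show thesis
    using that[of "sgn v"] \<open>v \<noteq> 0\<close> by (simp add: norm_sgn)
qed

lemma proj_point_eq_imp_scaleR:
  fixes u v :: "real ^ 'n"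
  assumes "proj_point u = proj_point v"
  obtains c where "u = c *\<^sub>R v"
  using assms span_base[of u "{u}"] by (auto simp: span_singleton)

text \<open>Proportional unit vectors differ by a factor of absolute value 1, that is, by a
  sign.\<close>

lemma antipodal_pair_eq_iff_proj_point_eq:
  fixes u v :: "real ^ 'n"
  assumes "norm u = 1" and "norm v = 1"
  shows "{u, - u} = {v, - v} \<longleftrightarrow> proj_point u = proj_point v"
proof
  have neg: "proj_point (- v) = proj_point v"
    using proj_point_scaleR[of "- 1" v] by simp
  assume "{u, - u} = {v, - v}"
  then have "u = v \<or> u = - v"
    by blast
  then show "proj_point u = proj_point v"
    using neg by auto
next
  assume "proj_point u = proj_point v"
  then obtain c where c: "u = c *\<^sub>R v"
    by (rule proj_point_eq_imp_scaleR)
  then have "\<bar>c\<bar> = 1"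
    using assms by simp
  then have "c = 1 \<or> c = - 1"
    by linarith
  then show "{u, - u} = {v, - v}"
    using c by auto
qed

lemma point_class_eq_iff:
  assumes "norm x = 1" "norm y = 1" "norm z = 1" "norm x' = 1" "norm y' = 1" "norm z' = 1"
  shows "point_class (x, y, z) = point_class (x', y', z') \<longleftrightarrow>
    (proj_point x, proj_point y, proj_point z) = (proj_point x', proj_point y', proj_point z')"
proof -
  have "point_class (x, y, z) = point_class (x', y', z') \<longleftrightarrow>
      {x, - x} = {x', - x'} \<and> {y, - y} = {y', - y'} \<and> {z, - z} = {z', - z'}"
    \<comment> \<open>The signs in a class are independent, so it is a product of nonempty sets, and
      such a product determines its factors.\<close>
    by (simp only: point_class.simps times_eq_iff insert_not_empty Times_empty simp_thms)
  then show ?thesis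
    using assms by (simp only: antipodal_pair_eq_iff_proj_point_eq prod.inject)
qed

text \<open>The Lagrange condition in projective terms. With g = 0 the right side would hold for
  \<alpha> = 0 whatever x is; g \<noteq> 0 forces \<alpha> \<noteq> 0, so scaling by 2\<alpha>
  preserves the line.\<close>

lemma proj_point_eq_iff_eigen:
  fixes g x :: "real ^ 'n"
  assumes "g \<noteq> 0"
  shows "proj_point g = proj_point x \<longleftrightarrow> (\<exists>\<alpha>. g = (2 * \<alpha>) *\<^sub>R x)"
proof
  assume "proj_point g = proj_point x"
  then obtain c where "g = c *\<^sub>R x"
    by (rule proj_point_eq_imp_scaleR)
  then have "g = (2 * (c / 2)) *\<^sub>R x"
    by simp
  then show "\<exists>\<alpha>. g = (2 * \<alpha>) *\<^sub>R x" ..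
next
  assume "\<exists>\<alpha>. g = (2 * \<alpha>) *\<^sub>R x"
  then obtain \<alpha> where "g = (2 * \<alpha>) *\<^sub>R x" ..
  then show "proj_point g = proj_point x"
    using assms proj_point_scaleR[of "2 * \<alpha>" x] by auto
qed

text \<open>By \<open>nabla_proj_point\<close> the map may be computed at x, y, z themselves. Lying
  in the domain means that all three gradients are nonzero, so
  \<open>proj_point_eq_iff_eigen\<close> applies to each factor; a fixed point lies in the domain
  because it has a value.\<close>

lemma extreme_point_iff_fixed_point:
  assumes "trilinear l" and "norm x = 1" "norm y = 1" "norm z = 1"
  shows "(x, y, z) \<in> extreme_points l \<and>
      (proj_point x, proj_point y, proj_point z) \<in> dom (nabla l) \<longleftrightarrow>
    (proj_point x, proj_point y, proj_point z) \<in> nabla_fixed_points l"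
proof -
  have "x \<noteq> 0" "y \<noteq> 0" "z \<noteq> 0"
    using assms by auto
  then show ?thesis
    using assms
    by (auto simp: extreme_points_def nabla_fixed_points_def nabla_proj_point
        proj_point_in_proj_space proj_point_eq_iff_eigen dom_def)
qed

theorem proposition6:
  fixes l :: "real ^ 'n \<Rightarrow> real ^ 'm \<Rightarrow> real ^ 's \<Rightarrow> real"
  assumes "trilinear l"
  shows "\<exists>f. bij_betw f
           (point_class ` {(x, y, z) \<in> extreme_points l.
              (proj_point x, proj_point y, proj_point z) \<in> dom (nabla l)})
           (nabla_fixed_points l) \<and>
         (\<forall>(x, y, z) \<in> extreme_points l.
            (proj_point x, proj_point y, proj_point z) \<in> dom (nabla l) \<longrightarrow>
            f (point_class (x, y, z)) = (proj_point x, proj_point y, proj_point z))"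
proof -
  define A where "A = {(x, y, z) \<in> extreme_points l.
    (proj_point x, proj_point y, proj_point z) \<in> dom (nabla l)}"
  define p :: "(real ^ 'n) \<times> (real ^ 'm) \<times> (real ^ 's) \<Rightarrow> _"
    where "p = (\<lambda>(x, y, z). (proj_point x, proj_point y, proj_point z))"
  have unit: "norm x = 1 \<and> norm y = 1 \<and> norm z = 1" if "(x, y, z) \<in> extreme_points l" for x y z
    using that by (auto simp: extreme_points_def)
  \<comment> \<open>Classes are exactly the fibres of \<open>p\<close> on \<open>A\<close>, as
    extreme points have unit coordinates.\<close>
  have "point_class a = point_class b \<longleftrightarrow> p a = p b" if "a \<in> A" "b \<in> A" for a b
  proof -
    obtain x y z x' y' z' where ab: "a = (x, y, z)" "b = (x', y', z')"
      by (metis prod_cases3)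
    then have "norm x = 1 \<and> norm y = 1 \<and> norm z = 1" "norm x' = 1 \<and> norm y' = 1 \<and> norm z' = 1"
      using that by (auto simp: A_def intro!: unit)
    then show ?thesis
      unfolding ab p_def prod.case by (intro point_class_eq_iff) blast+
  qed
  then obtain f where f: "bij_betw f (point_class ` A) (p ` A)"
      "\<And>a. a \<in> A \<Longrightarrow> f (point_class a) = p a"
    using bij_betw_image_quotient[of A point_class p] by blast
  have "p ` A = nabla_fixed_points l"
  proof
    show "p ` A \<subseteq> nabla_fixed_points l"
      using extreme_point_iff_fixed_point[OF assms] unit by (fastforce simp: A_def p_def)
    show "nabla_fixed_points l \<subseteq> p ` A"
    proof
      fix P
      assume P: "P \<in> nabla_fixed_points l"
      then obtain X Y Z where XYZ: "P = (X, Y, Z)" "X \<in> proj_space" "Y \<in> proj_space" "Z \<in> proj_space"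
        by (auto simp: nabla_fixed_points_def)
      \<comment> \<open>Any unit representatives will do: the equivalence read from right to left
        makes them an extreme point in \<open>A\<close>.\<close>
      obtain x where x: "norm x = 1" "X = proj_point x"
        using proj_space_unit_vector[OF XYZ(2)] .
      obtain y where y: "norm y = 1" "Y = proj_point y"
        using proj_space_unit_vector[OF XYZ(3)] .
      obtain z where z: "norm z = 1" "Z = proj_point z"
        using proj_space_unit_vector[OF XYZ(4)] .
      have "(x, y, z) \<in> A"
        using extreme_point_iff_fixed_point[OF assms x(1) y(1) z(1)] P XYZ(1) x(2) y(2) z(2)
        by (simp add: A_def)
      moreover have "P = p (x, y, z)"
        using XYZ(1) x(2) y(2) z(2) by (simp add: p_def)
      ultimately show "P \<in> p ` A"
        by blast
    qed
  qed
  with f have "bij_betw f (point_class ` A) (nabla_fixed_points l)"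
    by simp
  moreover have "\<forall>(x, y, z) \<in> extreme_points l.
      (proj_point x, proj_point y, proj_point z) \<in> dom (nabla l) \<longrightarrow>
      f (point_class (x, y, z)) = (proj_point x, proj_point y, proj_point z)"
  proof clarify
    fix x y z P
    assume "(x, y, z) \<in> extreme_points l"
      and "nabla l (proj_point x, proj_point y, proj_point z) = Some P"
    then have "(x, y, z) \<in> A"
      by (auto simp: A_def)
    then show "f (point_class (x, y, z)) = (proj_point x, proj_point y, proj_point z)"
      using f(2)[of "(x, y, z)"] by (simp add: p_def del: point_class.simps)
  qed
  ultimately show ?thesis
    unfolding A_def by blast
qed

end
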